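(* Let $n \ge 1$ and let $y = y[1..n]$ be a feasible array, i.e. an integer array with $y[1]=n$ and $0 \le y[i] \le n+1-i$ for every $i \in \{2,\dots,n\}$. Then there exist a finite alphabet $\Sigma$ and a string $x = x[1..n]$ (indeterminate or regular) with base alphabet $\Sigma$ such that $y$ is the prefix array of $x$.
   Context: A string of length $n$ with base alphabet $\Sigma$ (a finite set) is a sequence $x = x[1..n]$ of nonempty subsets of $\Sigma$. A letter (nonempty subset of $\Sigma$) is regular if it has exactly one element, otherwise indeterminate; a string is regular if all its letters are regular, otherwise indeterminate. Two letters $\lambda,\mu$ match, written $\lambda \approx \mu$, if $\lambda\cap\mu\neq\emptyset$. Two strings match if they have the same length and all corresponding letters match. The prefix array of $x=x[1..n]$ is the integer array $y[1..n]$ such that, for every $i \in \{1,\dots,n\}$, $y[i]$ is the length of the longest prefix of $x[i..n]$ that matches a prefix of $x$ (possibly $0$). *)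

theory Defs
  imports Main "HOL-Library.Sublist"
begin

text \<open>
  Strings and arrays are lists. HOL lists are 0-based, whereas positions \<open>i\<close> below range over
  \<open>1..n\<close>: the entry at position \<open>i\<close> of \<open>xs\<close> is \<open>xs ! (i - 1)\<close>, and the suffix \<open>x[i..n]\<close> is
  \<open>drop (i - 1) x\<close>.
\<close>

definition string_over :: "'a set \<Rightarrow> 'a set list \<Rightarrow> bool" where
  "string_over \<Sigma> x \<longleftrightarrow> (\<forall>l \<in> set x. l \<noteq> {} \<and> l \<subseteq> \<Sigma>)"

definition letter_match :: "'a set \<Rightarrow> 'a set \<Rightarrow> bool" where
  "letter_match l m \<longleftrightarrow> l \<inter> m \<noteq> {}"

definition string_match :: "'a set list \<Rightarrow> 'a set list \<Rightarrow> bool" where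
  "string_match u v \<longleftrightarrow>
     length u = length v \<and> (\<forall>j < length u. letter_match (u ! j) (v ! j))"

text \<open>The set under \<open>Max\<close> is finite and contains \<open>0\<close>, witnessed by the empty prefix.\<close>

definition longest_match :: "'a set list \<Rightarrow> nat \<Rightarrow> nat" where
  "longest_match x i =
     Max {length u | u. prefix u (drop (i - 1) x) \<and> (\<exists>v. prefix v x \<and> string_match u v)}"

definition is_prefix_array :: "int list \<Rightarrow> 'a set list \<Rightarrow> bool" where
  "is_prefix_array y x \<longleftrightarrow>
     length y = length x \<and>
     (\<forall>i \<in> {1..length x}. y ! (i - 1) = int (longest_match x i))"

definition feasible :: "nat \<Rightarrow> int list \<Rightarrow> bool" where
  "feasible n y \<longleftrightarrow>
     length y = n \<and> y ! 0 = int n \<and>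
     (\<forall>i \<in> {2..n}. 0 \<le> y ! (i - 1) \<and> y ! (i - 1) \<le> int n + 1 - int i)"

end

theory Submission
  imports Defs "HOL-Library.Nat_Bijection"
begin

text \<open>
  Count positions from \<open>0\<close>. The array prescribes which of them have to match: \<open>p\<close> matches \<open>p + d\<close> for all
  \<open>p < y[d + 1]\<close>, and \<open>p = y[d + 1]\<close> must not match \<open>p + d\<close>. As a pair of positions determines
  its difference \<open>d\<close>, these requirements never conflict. It thus suffices to realise an arbitrary
  reflexive symmetric relation by matching letters, and for this one takes the edges of its graph
  as the alphabet and lets the letter at \<open>p\<close> consist of the edges incident to \<open>p\<close>.
\<close>

text \<open>Listing each edge with \<open>a \<le> b\<close> makes \<open>R\<close> stand for the
  symmetric relation given by its values on such pairs. \<open>prod_encode\<close> turns edges into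
  natural numbers, so that the alphabet is a \<open>nat set\<close>.\<close>

definition incident_edges :: "(nat \<Rightarrow> nat \<Rightarrow> bool) \<Rightarrow> nat \<Rightarrow> nat \<Rightarrow> nat set" where
  "incident_edges R n p = {prod_encode (a, b) | a b. a \<le> b \<and> b < n \<and> R a b \<and> p \<in> {a, b}}"

lemma incident_edges_subset: "incident_edges R n p \<subseteq> prod_encode ` ({..<n} \<times> {..<n})"
  by (auto simp: incident_edges_def)

lemma incident_edges_nonempty:
  assumes "p < n" "R p p"
  shows "incident_edges R n p \<noteq> {}"
  using assms by (auto simp: incident_edges_def)

text \<open>If \<open>p < q\<close>, the only edge that can contain both is \<open>(p, q)\<close>.
  If \<open>p = q\<close>, a shared edge may be any edge at \<open>p\<close>, so
  \<open>R p p\<close> has to come from the assumption.\<close>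

lemma letter_match_incident_edges:
  assumes "p \<le> q" "q < n" "R p p"
  shows "letter_match (incident_edges R n q) (incident_edges R n p) \<longleftrightarrow> R p q"
proof
  assume "letter_match (incident_edges R n q) (incident_edges R n p)"
  then obtain e where "e \<in> incident_edges R n q" "e \<in> incident_edges R n p"
    unfolding letter_match_def by blast
  then obtain a b where "a \<le> b" "R a b" "p \<in> {a, b}" "q \<in> {a, b}"
    unfolding incident_edges_def by (fastforce simp: prod_encode_eq)
  with assms show "R p q" by auto
next
  assume "R p q"
  with assms have "prod_encode (p, q) \<in> incident_edges R n q \<inter> incident_edges R n p"
    by (auto simp: incident_edges_def)
  then show "letter_match (incident_edges R n q) (incident_edges R n p)"
    unfolding letter_match_def by blast
qed

text \<open>A prefix is determined by its length, so \<open>u\<close> and \<open>v\<close> are the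
  prefixes of one common length \<open>k\<close>.\<close>

lemma longest_match_eq_Max:
  "longest_match x i =
     Max {k. k \<le> length x - (i - 1) \<and> (\<forall>j<k. letter_match (x ! (i - 1 + j)) (x ! j))}"
proof -
  have "{length u | u. prefix u (drop (i - 1) x) \<and> (\<exists>v. prefix v x \<and> string_match u v)} =
        {k. k \<le> length x - (i - 1) \<and> (\<forall>j<k. letter_match (x ! (i - 1 + j)) (x ! j))}"
    (is "?L = ?R")
  proof (intro equalityI subsetI)
    fix k assume "k \<in> ?L"
    then obtain u v where k: "k = length u"
      and u: "prefix u (drop (i - 1) x)" and v: "prefix v x" and m: "string_match u v"
      by blast
    have "k \<le> length x - (i - 1)"
      using prefix_length_le[OF u] k by simp
    moreover have "letter_match (x ! (i - 1 + j)) (x ! j)" if "j < k" for j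
    proof -
      have "u ! j = x ! (i - 1 + j)"
        using u that k \<open>k \<le> length x - (i - 1)\<close>
        by (auto simp: prefix_def nth_append dest: arg_cong[of _ _ "\<lambda>l. l ! j"])
      moreover have "v ! j = x ! j"
        using v m that k by (auto simp: prefix_def nth_append string_match_def)
      ultimately show ?thesis
        using m that k by (auto simp: string_match_def)
    qed
    ultimately show "k \<in> ?R" by simp
  next
    fix k assume k: "k \<in> ?R"
    then have "string_match (take k (drop (i - 1) x)) (take k x)"
      by (auto simp: string_match_def)
    moreover have "length (take k (drop (i - 1) x)) = k"
      using k by simp
    ultimately show "k \<in> ?L"
      using take_is_prefix by (metis (mono_tags, lifting) mem_Collect_eq)
  qed
  then show ?thesis
    by (simp add: longest_match_def)
qed

theorem lemma7:
  fixes n :: nat and y :: "int list"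
  assumes "n \<ge> 1" and "feasible n y"
  shows "\<exists>(\<Sigma> :: nat set) x. finite \<Sigma> \<and> string_over \<Sigma> x \<and> length x = n \<and> is_prefix_array y x"
proof -
  \<comment> \<open>For \<open>a \<le> b\<close> the shift is \<open>d = b - a\<close>, and the
    0-based \<open>y ! d\<close> is the entry at position \<open>d + 1\<close>.\<close>
  define R where "R a b \<longleftrightarrow> int a < y ! (b - a)" for a b
  define \<Sigma> where "\<Sigma> = prod_encode ` ({..<n} \<times> {..<n})"
  define x where "x = map (incident_edges R n) [0..<n]"
  have y0: "y ! 0 = int n" and len: "length y = n"
    using assms by (auto simp: feasible_def)
  have bounds: "0 \<le> y ! d \<and> y ! d \<le> int (n - d)" if "d < n" for d
  proof (cases "d = 0")
    case False
    then have "d + 1 \<in> {2..n}" using that by auto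
    with assms(2) have "0 \<le> y ! (d + 1 - 1) \<and> y ! (d + 1 - 1) \<le> int n + 1 - int (d + 1)"
      unfolding feasible_def by blast
    then show ?thesis using that by simp
  qed (simp add: y0)
  \<comment> \<open>The entry \<open>y ! 0 = int n\<close> supplies a loop at every position, hence
    nonempty letters.\<close>
  have refl: "R p p" if "p < n" for p
    using that y0 by (simp add: R_def)
  have "string_over \<Sigma> x"
    using incident_edges_subset[of R n] incident_edges_nonempty[of _ n R] refl
    by (auto simp: string_over_def x_def \<Sigma>_def)
  moreover have "y ! (i - 1) = int (longest_match x i)" if i: "i \<in> {1..n}" for i
  proof -
    define d where "d = i - 1"
    have d: "d < n" using i by (auto simp: d_def)
    have match: "letter_match (x ! (d + j)) (x ! j) \<longleftrightarrow> int j < y ! d" if "d + j < n" for j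
      using that letter_match_incident_edges[of j "d + j" n R] refl[of j]
      by (simp add: x_def R_def)
    \<comment> \<open>For \<open>k \<le> n - d\<close> all indices \<open>d + j\<close> stay below
      \<open>n\<close>, so \<open>match\<close> applies. Conversely, feasibility gives
      \<open>y ! d \<le> n - d\<close>, so every \<open>k\<close> up to \<open>nat (y ! d)\<close>
      meets that bound.\<close>
    have "{k. k \<le> n - d \<and> (\<forall>j<k. letter_match (x ! (d + j)) (x ! j))} = {..nat (y ! d)}"
      (is "?K = _")
    proof -
      have "k \<in> ?K \<longleftrightarrow> k \<le> n - d \<and> (\<forall>j<k. int j < y ! d)" for k
        using match by auto
      moreover have "(\<forall>j<k. int j < y ! d) \<longleftrightarrow> k \<le> nat (y ! d)" for k
        using bounds[OF d] by (cases k) (force simp: less_Suc_eq_le)+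
      ultimately show ?thesis
        using bounds[OF d] by auto
    qed
    then have "longest_match x i = nat (y ! d)"
      unfolding longest_match_eq_Max by (simp add: d_def x_def Max_eq_iff)
    then show ?thesis
      using bounds[OF d] by (simp add: d_def)
  qed
  ultimately show ?thesis
    by (intro exI[of _ \<Sigma>] exI[of _ x]) (auto simp: is_prefix_array_def len x_def \<Sigma>_def)
qed

end
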